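(* Let $K\subset\mathbb R$ be a regular Cantor set of Hausdorff dimension $d$, let $0<p<1$, and let $\tilde K\subset\mathbb R$ be a Cantor set of positive Lebesgue measure satisfying condition $(\mathcal C_p)$. If $d+p<1$, then for all sufficiently small $\lambda>0$ the set $$\{t\in\mathbb R:\ t+\lambda K\subset\tilde K\}$$ has positive Lebesgue measure.
   Context: Condition $(\mathcal C_p)$, $0<p<1$: a compact set $\tilde K\subset\mathbb R$ with convex hull $[a,a+\operatorname{diam}\tilde K]$, whose complementary components in the hull are the open intervals $(a_n,b_n)$, satisfies $(\mathcal C_p)$ if $\sum_n (b_n-a_n)^p<\infty$. Regular Cantor set: a Cantor set $K\subset\mathbb R$ is $C^k$-regular ($k\ge1$) if (i) there are disjoint compact intervals $I_1,\dots,I_r$ such that $K\subset I_1\cup\dots\cup I_r$ and the boundary of each $I_j$ is contained in $K$; (ii) there is a $C^k$ expanding map $\psi$ defined in a neighbourhood of $I_1\cup\dots\cup I_r$ such that each $\psi(I_j)$ is the convex hull of a finite union of some of the intervals $I_s$, for each $j$ and all sufficiently large $n$ one has $\psi^n(K\cap I_j)=K$, and $K=\bigcap_{n\in\mathbb N}\psi^{-n}(I_1\cup\dots\cup I_r)$. "Regular" means $C^k$-regular for some $k\ge 1$. For regular Cantor sets of class $C^{1+\alpha}$ it is a known theorem that the Hausdorff dimension $d$ equals the box dimension and that $\sup_{0<\epsilon\le\operatorname{diam}K}N_\epsilon(K)\epsilon^d<\infty$, where $N_\epsilon(K)$ is the minimal number of open intervals of diameter $\epsilon$ covering $K$. *)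

theory Defs
  imports "HOL-Analysis.Analysis"
begin

section \<open>Hausdorff dimension\<close>

text \<open>The bound \<open>bounded (U i)\<close> is needed because \<^const>\<open>diameter\<close> carries no information on
  unbounded sets.  The two measures below are meant for \<open>s > 0\<close> only: there the empty set
  contributes \<open>0 powr s = 0\<close>, so countable covers subsume finite ones.\<close>

definition hausdorff_premeasure :: "real \<Rightarrow> real \<Rightarrow> 'a::metric_space set \<Rightarrow> ennreal" where
  "hausdorff_premeasure s \<delta> E =
     (INF U \<in> {U :: nat \<Rightarrow> 'a set. (\<forall>i. bounded (U i) \<and> diameter (U i) \<le> \<delta>) \<and> E \<subseteq> (\<Union>i. U i)}.
        (\<Sum>i. ennreal (diameter (U i) powr s)))"

definition hausdorff_outer_measure :: "real \<Rightarrow> 'a::metric_space set \<Rightarrow> ennreal" where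
  "hausdorff_outer_measure s E = (SUP \<delta> \<in> {0<..}. hausdorff_premeasure s \<delta> E)"

text \<open>Leaving out the exponent \<open>s = 0\<close> does not change the infimum for nonempty sets.\<close>

definition hausdorff_dim :: "'a::metric_space set \<Rightarrow> ereal" where
  "hausdorff_dim E = Inf {ereal s | s. 0 < s \<and> hausdorff_outer_measure s E = 0}"

section \<open>Regular Cantor sets\<close>

definition cantor_set :: "real set \<Rightarrow> bool" where
  "cantor_set K \<longleftrightarrow>
     K \<noteq> {} \<and> compact K \<and> (\<forall>x\<in>K. x islimpt K) \<and>
     (\<forall>x\<in>K. connected_component_set K x = {x})"

text \<open>To be used on open sets \<open>U\<close>, where \<^const>\<open>deriv\<close> at a point of \<open>U\<close> depends only on the
  values of the function on \<open>U\<close>.\<close>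

definition C_k_on :: "nat \<Rightarrow> (real \<Rightarrow> real) \<Rightarrow> real set \<Rightarrow> bool" where
  "C_k_on k f U \<longleftrightarrow>
     (\<forall>i<k. (deriv ^^ i) f differentiable_on U) \<and> continuous_on U ((deriv ^^ k) f)"

text \<open>The intervals are \<open>I s = {a s..b s}\<close> for \<open>s < r\<close>.  The map \<open>\<psi>\<close> is a total function of which
  only the restriction to the neighbourhood \<open>U\<close> matters.  The intersection of the preimages
  \<open>\<psi>\<^sup>-\<^sup>n(I\<^sub>1 \<union> \<dots> \<union> I\<^sub>r)\<close> runs over all \<open>n \<ge> 0\<close>, so its points have their entire orbit inside \<open>U\<close>.\<close>

definition Ck_regular_cantor_set :: "nat \<Rightarrow> real set \<Rightarrow> bool" where
  "Ck_regular_cantor_set k K \<longleftrightarrow> cantor_set K \<and>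
     (\<exists>(r::nat) (a :: nat \<Rightarrow> real) (b :: nat \<Rightarrow> real) (U :: real set) (\<psi> :: real \<Rightarrow> real).
        (\<forall>s<r. a s < b s) \<and>
        disjoint_family_on (\<lambda>s. {a s..b s}) {..<r} \<and>
        K \<subseteq> (\<Union>s<r. {a s..b s}) \<and>
        (\<forall>s<r. frontier {a s..b s} \<subseteq> K) \<and>
        open U \<and> (\<Union>s<r. {a s..b s}) \<subseteq> U \<and>
        C_k_on k \<psi> U \<and>
        (\<exists>\<sigma>>1. \<forall>x\<in>U. \<bar>deriv \<psi> x\<bar> \<ge> \<sigma>) \<and>
        (\<forall>j<r. \<exists>S \<subseteq> {..<r}. \<psi> ` {a j..b j} = convex hull (\<Union>s\<in>S. {a s..b s})) \<and>
        (\<forall>j<r. \<exists>N. \<forall>n\<ge>N. (\<psi> ^^ n) ` (K \<inter> {a j..b j}) = K) \<and>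
        K = (\<Inter>n. (\<psi> ^^ n) -` (\<Union>s<r. {a s..b s})))"

definition regular_cantor_set :: "real set \<Rightarrow> bool" where
  "regular_cantor_set K \<longleftrightarrow> (\<exists>k\<ge>1. Ck_regular_cantor_set k K)"

section \<open>The gap condition\<close>

text \<open>For \<open>K\<close> compact, every component of \<open>convex hull K - K\<close> is a nonempty bounded open interval,
  hence corresponds to exactly one pair of end points.\<close>

definition gaps :: "real set \<Rightarrow> (real \<times> real) set" where
  "gaps K = {(a, b). {a<..<b} \<in> components (convex hull K - K)}"

definition gap_condition :: "real \<Rightarrow> real set \<Rightarrow> bool" where
  "gap_condition p K \<longleftrightarrow> compact K \<and> (\<lambda>(a, b). (b - a) powr p) summable_on gaps K"

end

theory Submission
  imports Defs
begin

text \<open>Translating a gap \<open>(a, b)\<close> of \<open>K'\<close> by \<open>- l * x\<close> for all \<open>x \<in> K\<close> sweeps out the parameters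
  for which \<open>t + l K\<close> meets that gap.  Covering \<open>K\<close> at scale \<open>(b - a) / l\<close> bounds what is swept
  out beyond the gap itself by a constant times \<open>l powr (1 - p) * (b - a) powr p\<close>, provided that
  the covering numbers of \<open>K\<close> are \<open>O(\<epsilon> powr - (1 - p))\<close>.  The sum over all gaps tends to \<open>0\<close> with
  \<open>l\<close>, so most of \<open>K'\<close> survives.

  The covering bound is only needed for an exponent above the Hausdorff dimension, which makes it
  available for maps that are merely \<open>C\<^sup>1\<close>.  A cover of \<open>K\<close> by small pieces with small
  \<open>s'\<close>-dimensional sum is renormalised: an iterate of the expanding map blows each piece up to a
  part of \<open>K\<close> of definite size, nearly conformally, so covers of \<open>K\<close> at coarser scales pull back to
  covers of the pieces.\<close>

section \<open>Covering numbers and their renormalisation\<close>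

text \<open>Arbitrary pieces instead of balls, so that preimages of covers are again covers. The
  pairwise distance bound avoids \<open>diameter\<close> on unbounded sets, and a real
  \<open>N\<close> accepts bounds such as \<open>A * \<epsilon> powr - s\<close> without
  rounding.\<close>

definition coverable :: "'a::metric_space set \<Rightarrow> real \<Rightarrow> real \<Rightarrow> bool" where
  "coverable K \<epsilon> N \<longleftrightarrow>
     (\<exists>\<C>. finite \<C> \<and> real (card \<C>) \<le> N \<and> K \<subseteq> \<Union>\<C> \<and> (\<forall>A\<in>\<C>. \<forall>x\<in>A. \<forall>y\<in>A. dist x y \<le> \<epsilon>))"

lemma coverable_mono:
  assumes "coverable K \<epsilon> N" "\<epsilon> \<le> \<epsilon>'" "N \<le> N'"
  shows "coverable K \<epsilon>' N'"
  using assms unfolding coverable_def by (meson order_trans)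

lemma coverable_compact:
  assumes "compact K" "\<epsilon> > 0"
  shows "\<exists>N. coverable K \<epsilon> N"
proof -
  have cov: "K \<subseteq> (\<Union>x\<in>K. ball x (\<epsilon>/2))"
    using assms(2) by (intro subsetI UN_I) auto
  from compactE_image[OF assms(1) open_ball cov] obtain P
    where P: "finite P" "K \<subseteq> (\<Union>x\<in>P. ball x (\<epsilon>/2))"
    by metis
  have "dist x y \<le> \<epsilon>" if "x \<in> ball c (\<epsilon>/2)" "y \<in> ball c (\<epsilon>/2)" for c x y :: 'a
    using that dist_triangle_half_r[of c x \<epsilon> y] by (auto simp: dist_commute)
  hence "coverable K \<epsilon> (real (card ((\<lambda>x. ball x (\<epsilon>/2)) ` P)))"
    unfolding coverable_def using P by (intro exI[of _ "(\<lambda>x. ball x (\<epsilon>/2)) ` P"]) auto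
  thus ?thesis by blast
qed

text \<open>Preimages of the pieces, cut down to \<open>W\<close>, cover \<open>W\<close>, and the
  expansion shrinks their size by the factor \<open>L\<close>.\<close>

lemma coverable_pullback:
  fixes f :: "'a::metric_space \<Rightarrow> 'b::metric_space"
  assumes "coverable K (\<epsilon> * L) N" "f ` W \<subseteq> K" "L > 0"
    and "\<And>x y. x \<in> W \<Longrightarrow> y \<in> W \<Longrightarrow> L * dist x y \<le> dist (f x) (f y)"
  shows "coverable W \<epsilon> N"
proof -
  obtain \<C> where C: "finite \<C>" "real (card \<C>) \<le> N" "K \<subseteq> \<Union>\<C>"
      "\<And>A x y. A \<in> \<C> \<Longrightarrow> x \<in> A \<Longrightarrow> y \<in> A \<Longrightarrow> dist x y \<le> \<epsilon> * L"
    using assms(1) unfolding coverable_def by blast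
  let ?D = "(\<lambda>A. {x \<in> W. f x \<in> A}) ` \<C>"
  have "card ?D \<le> card \<C>" using C(1) by (rule card_image_le)
  moreover have "dist x y \<le> \<epsilon>" if "A \<in> \<C>" "x \<in> W" "y \<in> W" "f x \<in> A" "f y \<in> A" for A x y
  proof -
    have "L * dist x y \<le> L * \<epsilon>"
      using assms(4)[OF that(2,3)] C(4)[OF that(1,4,5)] by (simp add: mult.commute)
    thus ?thesis using assms(3) by simp
  qed
  moreover have "W \<subseteq> \<Union>?D" using assms(2) C(3) by fastforce
  ultimately show ?thesis
    unfolding coverable_def using C(1,2) by (intro exI[of _ ?D]) auto
qed

lemma coverable_UN:
  assumes "finite F" "K \<subseteq> (\<Union>i\<in>F. W i)" "\<And>i. i \<in> F \<Longrightarrow> coverable (W i) \<epsilon> (N i)"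
  shows "coverable K \<epsilon> (\<Sum>i\<in>F. N i)"
proof -
  obtain \<C> where C: "\<And>i. i \<in> F \<Longrightarrow> finite (\<C> i) \<and> real (card (\<C> i)) \<le> N i \<and> W i \<subseteq> \<Union>(\<C> i) \<and>
       (\<forall>A\<in>\<C> i. \<forall>x\<in>A. \<forall>y\<in>A. dist x y \<le> \<epsilon>)"
    using assms(3) unfolding coverable_def by metis
  have "real (card (\<Union>i\<in>F. \<C> i)) \<le> real (\<Sum>i\<in>F. card (\<C> i))"
    using card_UN_le[OF assms(1)] of_nat_le_iff by blast
  also have "\<dots> \<le> (\<Sum>i\<in>F. N i)" using C by (auto intro: sum_mono)
  finally have "real (card (\<Union>i\<in>F. \<C> i)) \<le> (\<Sum>i\<in>F. N i)" .
  moreover have "K \<subseteq> \<Union>(\<Union>i\<in>F. \<C> i)"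
  proof
    fix x assume "x \<in> K"
    then obtain i where i: "i \<in> F" "x \<in> W i" using assms(2) by auto
    with C[OF i(1)] have "x \<in> \<Union>(\<C> i)" by (auto dest: subsetD)
    thus "x \<in> \<Union>(\<Union>i\<in>F. \<C> i)" using i(1) by auto
  qed
  ultimately show ?thesis
    unfolding coverable_def using C assms(1) by (intro exI[of _ "\<Union>i\<in>F. \<C> i"]) auto
qed

text \<open>The covering number satisfies \<open>N \<epsilon> \<le> (\<Sum>i. N (\<epsilon> * L i))\<close>, and \<open>(\<Sum>i. L i powr - s) \<le> 1\<close>
  makes \<open>A * \<epsilon> powr - s\<close> a supersolution of this recursion.\<close>

lemma coverable_self_expanding:
  fixes K :: "'a::metric_space set" and L :: "'i \<Rightarrow> real"
  assumes "compact K" "finite F" "s > 0" "K \<subseteq> (\<Union>i\<in>F. W i)"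
    and L: "\<And>i. i \<in> F \<Longrightarrow> L i > 1"
    and f: "\<And>i. i \<in> F \<Longrightarrow> f i ` W i \<subseteq> K"
    and expand: "\<And>i x y. i \<in> F \<Longrightarrow> x \<in> W i \<Longrightarrow> y \<in> W i \<Longrightarrow> L i * dist x y \<le> dist (f i x) (f i y)"
    and sum: "(\<Sum>i\<in>F. L i powr - s) \<le> 1"
  shows "\<exists>A\<ge>0. \<forall>\<epsilon>. 0 < \<epsilon> \<longrightarrow> \<epsilon> \<le> 1 \<longrightarrow> coverable K \<epsilon> (A * \<epsilon> powr - s)"
proof -
  \<comment> \<open>The inserted 2 and 1 keep \<open>Min\<close> and \<open>Max\<close> meaningful
    for empty \<open>F\<close> and give \<Lambda> > 1 and \<open>E\<close> \<ge> 1.\<close>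
  define \<Lambda> where "\<Lambda> = Min (insert 2 (L ` F))"
  define E where "E = Max (insert 1 (L ` F))"
  have \<Lambda>: "\<Lambda> > 1" "\<And>i. i \<in> F \<Longrightarrow> \<Lambda> \<le> L i"
    using L assms(2) by (auto simp: \<Lambda>_def)
  have E: "E \<ge> 1" "\<And>i. i \<in> F \<Longrightarrow> L i \<le> E"
    using assms(2) by (auto simp: E_def)
  obtain N where N: "coverable K 1 N" using coverable_compact[OF assms(1), of 1] by auto
  have N0: "N \<ge> 0" using N unfolding coverable_def by (meson of_nat_0_le_iff order_trans)
  \<comment> \<open>A scale below 1 may overshoot 1 when multiplied by \<open>L i\<close>, but not
    beyond \<open>E\<close>. The factor \<open>E powr s\<close> lets the one cover at scale 1 serve
    all scales from 1 to \<open>E\<close>.\<close>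
  define A where "A = N * E powr s"
  have A0: "A \<ge> 0" using N0 by (simp add: A_def)
  have base: "coverable K \<epsilon> (A * \<epsilon> powr - s)" if "1 \<le> \<epsilon>" "\<epsilon> \<le> E" for \<epsilon>
  proof (rule coverable_mono[OF N that(1)])
    have "1 \<le> (E / \<epsilon>) powr s" using that assms(3) by (intro ge_one_powr_ge_zero) auto
    also have "\<dots> = E powr s * \<epsilon> powr - s"
      using that E(1) by (simp add: powr_divide powr_minus_divide)
    finally show "N \<le> A * \<epsilon> powr - s"
      using N0 mult_left_mono[of 1 "E powr s * \<epsilon> powr - s" N] by (simp add: A_def mult.assoc)
  qed
  \<comment> \<open>\<open>k\<close> bounds the number of renormalisations: each multiplies the
    scale by at least \<Lambda>, until it reaches 1.\<close>
  have step: "coverable K \<epsilon> (A * \<epsilon> powr - s)" if "1 \<le> \<epsilon> * \<Lambda> ^ k" "0 < \<epsilon>" "\<epsilon> \<le> E" for k \<epsilon>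
    using that
  proof (induction k arbitrary: \<epsilon>)
    case 0
    thus ?case using base by simp
  next
    case (Suc k)
    show ?case
    proof (cases "\<epsilon> \<ge> 1")
      case True
      thus ?thesis using base Suc.prems by simp
    next
      case False
      have "coverable (W i) \<epsilon> (A * (\<epsilon> * L i) powr - s)" if "i \<in> F" for i
      proof (rule coverable_pullback[of K _ "L i" _ "f i"])
        have "1 \<le> \<epsilon> * \<Lambda> * \<Lambda> ^ k" using Suc.prems by (simp add: mult_ac)
        also have "\<dots> \<le> \<epsilon> * L i * \<Lambda> ^ k"
          using \<Lambda> that Suc.prems by (intro mult_right_mono mult_left_mono) auto
        finally have "1 \<le> \<epsilon> * L i * \<Lambda> ^ k" .
        moreover have "\<epsilon> * L i \<le> 1 * E"
          using False E that Suc.prems L[OF that] by (intro mult_mono) auto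
        ultimately show "coverable K (\<epsilon> * L i) (A * (\<epsilon> * L i) powr - s)"
          using Suc.IH[of "\<epsilon> * L i"] Suc.prems L[OF that] by simp
      qed (use L f expand that in \<open>auto simp: less_trans[OF zero_less_one]\<close>)
      hence "coverable K \<epsilon> (\<Sum>i\<in>F. A * (\<epsilon> * L i) powr - s)"
        by (rule coverable_UN[OF assms(2,4)])
      moreover have "(\<Sum>i\<in>F. A * (\<epsilon> * L i) powr - s) = A * \<epsilon> powr - s * (\<Sum>i\<in>F. L i powr - s)"
        unfolding sum_distrib_left using Suc.prems L
        by (intro sum.cong) (auto simp: powr_mult less_imp_le[OF less_trans[OF zero_less_one]])
      moreover have "\<dots> \<le> A * \<epsilon> powr - s * 1"
        using sum A0 by (intro mult_left_mono) auto
      ultimately show ?thesis by (auto intro: coverable_mono)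
    qed
  qed
  have "coverable K \<epsilon> (A * \<epsilon> powr - s)" if e: "0 < \<epsilon>" "\<epsilon> \<le> 1" for \<epsilon>
  proof -
    obtain k where "1 / \<epsilon> < \<Lambda> ^ k" using real_arch_pow[OF \<Lambda>(1)] by blast
    hence "1 \<le> \<epsilon> * \<Lambda> ^ k" using e(1) by (simp add: field_simps)
    thus ?thesis using step e E(1) by simp
  qed
  with A0 show ?thesis by blast
qed

section \<open>Finite covers from Hausdorff measure zero\<close>

text \<open>Thickening the sets of a countable cover to open ones lets compactness pick a finite
  subcover. The sizes \<open>D i\<close> are positive even for single points, because they later
  serve as scales for blowing up.\<close>

lemma hausdorff_null_finite_cover:
  fixes K :: "'a::metric_space set"
  assumes "compact K" "hausdorff_outer_measure s K = 0" "s > 0" "\<eta> > 0"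
  shows "\<exists>(F::nat set) V D. finite F \<and> K \<subseteq> (\<Union>i\<in>F. V i) \<and> (\<forall>i\<in>F. D i > 0) \<and>
           (\<forall>i\<in>F. \<forall>x\<in>V i. \<forall>y\<in>V i. dist x y \<le> D i) \<and> (\<Sum>i\<in>F. D i powr s) < \<eta>"
proof -
  \<comment> \<open>Any scale in place of 1 would do, since a small sum already forces small
    pieces.\<close>
  have "hausdorff_premeasure s 1 K \<le> hausdorff_outer_measure s K"
    unfolding hausdorff_outer_measure_def by (rule SUP_upper) simp
  hence "hausdorff_premeasure s 1 K < ennreal (\<eta>/2)" using assms by simp
  then obtain U :: "nat \<Rightarrow> 'a set" where U: "\<And>i. bounded (U i)" "K \<subseteq> (\<Union>i. U i)"
      "(\<Sum>i. ennreal (diameter (U i) powr s)) < ennreal (\<eta>/2)"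
    unfolding hausdorff_premeasure_def Inf_less_iff by auto
  \<comment> \<open>The slack in the \<open>s\<close>-th power makes \<open>D i\<close> exceed the
    diameter, also when that is zero, and adds at most \<open>\<eta>/2\<close> to the sum.\<close>
  define D where "D i = (diameter (U i) powr s + \<eta> / 2 * (1/2) ^ Suc i) powr (1/s)" for i
  have Ds: "D i powr s = diameter (U i) powr s + \<eta> / 2 * (1/2) ^ Suc i" for i
    using assms(3,4) by (simp add: D_def powr_powr)
  have Dd: "diameter (U i) < D i" for i
  proof (rule ccontr)
    assume "\<not> diameter (U i) < D i"
    hence "D i powr s \<le> diameter (U i) powr s"
      using assms(3) by (intro powr_mono2) (auto simp: D_def)
    moreover have "\<eta> / 2 * (1/2) ^ Suc i > 0" using assms(4) by simp
    ultimately show False using Ds[of i] by linarith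
  qed
  have D0: "D i > 0" for i using Dd[of i] diameter_ge_0[OF U(1)[of i]] by linarith
  \<comment> \<open>Half of the excess, because thickening moves both ends of a distance.\<close>
  define r where "r i = (D i - diameter (U i)) / 2" for i
  define V where "V i = (\<Union>u\<in>U i. ball u (r i))" for i
  have r0: "r i > 0" for i using Dd by (simp add: r_def)
  have "x \<in> V i" if "x \<in> U i" for x i
    unfolding V_def by (rule UN_I[OF that]) (simp add: r0)
  hence "(\<Union>i. U i) \<subseteq> (\<Union>i. V i)" by (intro UN_mono) auto
  hence cov: "K \<subseteq> (\<Union>i. V i)" using U(2) by (rule order_trans[rotated])
  have "open (V i)" for i unfolding V_def by (intro open_UN ballI open_ball)
  from compactE_image[OF assms(1) this cov] obtain F
    where F: "finite F" "K \<subseteq> (\<Union>i\<in>F. V i)"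
    by metis
  have "dist x y \<le> D i" if xy: "x \<in> V i" "y \<in> V i" for x y i
  proof -
    obtain u v where uv: "u \<in> U i" "v \<in> U i" "dist u x < r i" "dist v y < r i"
      using xy by (auto simp: V_def)
    have "dist x y \<le> dist u x + dist u v + dist v y"
      by (metis (no_types) add_mono_thms_linordered_semiring(3) dist_commute dist_triangle2 dist_triangle order_trans)
    thus ?thesis using uv diameter_bounded_bound[OF U(1) uv(1,2)] by (simp add: r_def field_simps)
  qed
  moreover have "(\<Sum>i\<in>F. D i powr s) < \<eta>"
  proof -
    have "ennreal (\<Sum>i\<in>F. diameter (U i) powr s) = (\<Sum>i\<in>F. ennreal (diameter (U i) powr s))"
      by simp
    also have "\<dots> \<le> (\<Sum>i. ennreal (diameter (U i) powr s))"
      using F(1) by (intro sum_le_suminf) auto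
    also note U(3)
    finally have 1: "(\<Sum>i\<in>F. diameter (U i) powr s) < \<eta>/2"
      by (simp add: ennreal_less_iff sum_nonneg)
    have "(\<Sum>i\<in>F. (1/2) ^ Suc i) \<le> (\<Sum>i. (1/2::real) ^ Suc i)"
      using F(1) power_half_series by (intro sum_le_suminf) (auto simp: sums_iff)
    also have "\<dots> = 1" using power_half_series by (simp add: sums_iff)
    finally have "\<eta>/2 * (\<Sum>i\<in>F. (1/2) ^ Suc i) \<le> \<eta>/2 * 1"
      using assms(4) by (intro mult_left_mono) auto
    with 1 show ?thesis
      unfolding Ds sum.distrib sum_distrib_left[symmetric] by simp
  qed
  ultimately show ?thesis using F D0
    by (intro exI[of _ F] exI[of _ V] exI[of _ D] conjI ballI)
qed

section \<open>Distortion of expanding maps and their iterates\<close>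

text \<open>By continuity the derivative is nearly constant around each point, so the mean value
  theorem gives both bounds; a Lebesgue number makes the radius uniform. The upper rate is a power
  of the lower rate \<open>m\<close> because this relation survives multiplication along orbits,
  unlike a constant factor.\<close>

lemma expanding_map_local_distortion:
  fixes \<psi> :: "real \<Rightarrow> real"
  assumes "compact K" "open U" "K \<subseteq> U" "\<psi> differentiable_on U" "continuous_on U (deriv \<psi>)"
    and "\<sigma> > 1" "\<And>x. x \<in> U \<Longrightarrow> \<bar>deriv \<psi> x\<bar> \<ge> \<sigma>" "\<theta> > 0"
  shows "\<exists>\<rho>>0. \<forall>x0\<in>K. \<exists>m\<ge>\<sigma>. \<forall>x\<in>ball x0 \<rho>. \<forall>y\<in>ball x0 \<rho>.
           m * dist x y \<le> dist (\<psi> x) (\<psi> y) \<and> dist (\<psi> x) (\<psi> y) \<le> m powr (1 + \<theta>) * dist x y"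
proof -
  let ?P = "\<lambda>B m. m \<ge> \<sigma> \<and> (\<forall>x\<in>B. \<forall>y\<in>B.
           m * dist x y \<le> dist (\<psi> x) (\<psi> y) \<and> dist (\<psi> x) (\<psi> y) \<le> m powr (1 + \<theta>) * dist x y)"
  \<comment> \<open>The derivative may vary by a factor \<tau> either way, so upper and lower rate
    differ by at most \<open>\<tau>\<^sup>2 = \<sigma> powr \<theta>\<close>, which is at most
    \<open>m powr \<theta>\<close>.\<close>
  define \<tau> where "\<tau> = \<sigma> powr (\<theta>/2)"
  have \<tau>: "\<tau> > 1" using assms by (simp add: \<tau>_def)
  have loc: "\<exists>B. open B \<and> c \<in> B \<and> (\<exists>m. ?P B m)" if c: "c \<in> K" for c
  proof -
    define g where "g = \<bar>deriv \<psi> c\<bar>"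
    have cU: "c \<in> U" using c assms by auto
    have g: "g \<ge> \<sigma>" using assms(7)[OF cU] by (simp add: g_def)
    have "isCont (deriv \<psi>) c" using assms(2,5) cU continuous_on_eq_continuous_at by blast
    hence tend: "((\<lambda>x. \<bar>deriv \<psi> x\<bar>) \<longlongrightarrow> g) (nhds c)"
      unfolding g_def isCont_def tendsto_at_iff_tendsto_nhds by (rule tendsto_rabs)
    have "g / \<tau> < g" "g < g * \<tau>" using g assms(6) \<tau> by (auto simp: field_simps)
    hence "\<forall>\<^sub>F x in nhds c. x \<in> U \<and> g / \<tau> < \<bar>deriv \<psi> x\<bar> \<and> \<bar>deriv \<psi> x\<bar> < g * \<tau>"
      using order_tendstoD[OF tend] assms(2) cU
      by (intro eventually_conj) (auto simp: eventually_nhds_in_open)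
    then obtain e where e: "e > 0"
        "\<And>x. dist x c < e \<Longrightarrow> x \<in> U \<and> g / \<tau> < \<bar>deriv \<psi> x\<bar> \<and> \<bar>deriv \<psi> x\<bar> < g * \<tau>"
      unfolding eventually_nhds_metric by blast
    \<comment> \<open>\<open>g / \<tau>\<close> may drop below \<sigma>, but \<sigma> itself bounds
      the derivative from below on all of \<open>U\<close>.\<close>
    define m where "m = max \<sigma> (g / \<tau>)"
    have m: "m \<ge> \<sigma>" "m \<ge> g / \<tau>" by (auto simp: m_def)
    have "g * \<tau> = g / \<tau> * \<tau>\<^sup>2" using \<tau> by (simp add: power2_eq_square)
    also have "\<dots> \<le> m * m powr \<theta>"
    proof (intro mult_mono)
      have "\<tau>\<^sup>2 = \<sigma> powr \<theta>" using assms(6)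
        by (simp add: \<tau>_def power2_eq_square powr_add[symmetric])
      also have "\<dots> \<le> m powr \<theta>" using m assms by (intro powr_mono2) auto
      finally show "\<tau>\<^sup>2 \<le> m powr \<theta>" .
    qed (use m assms(6) in auto)
    also have "\<dots> = m powr (1 + \<theta>)" using m assms(6) by (simp add: powr_add)
    finally have up: "g * \<tau> \<le> m powr (1 + \<theta>)" .
    have mvt: "m * dist x y \<le> dist (\<psi> x) (\<psi> y) \<and> dist (\<psi> x) (\<psi> y) \<le> m powr (1 + \<theta>) * dist x y"
      if xy: "x \<in> ball c e" "y \<in> ball c e" "x < y" for x y
    proof -
      have sub: "z \<in> ball c e" if "x \<le> z" "z \<le> y" for z
        using xy that by (auto simp: dist_real_def)
      have der: "(\<psi> has_real_derivative deriv \<psi> z) (at z)" if "x \<le> z" "z \<le> y" for z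
      proof -
        have "z \<in> U" using e(2)[of z] sub[OF that] by (simp add: dist_commute)
        hence "\<psi> differentiable at z"
          using assms(2,4) by (metis at_within_open differentiable_on_def)
        thus ?thesis using DERIV_deriv_iff_real_differentiable by blast
      qed
      obtain z where z: "x < z" "z < y" "\<psi> y - \<psi> x = (y - x) * deriv \<psi> z"
        using MVT2[OF xy(3) der] by blast
      have "dist (\<psi> x) (\<psi> y) = \<bar>deriv \<psi> z\<bar> * dist x y"
        using z(3) xy(3) abs_minus_commute[of "\<psi> x" "\<psi> y"] by (simp add: dist_real_def abs_mult)
      moreover have "m \<le> \<bar>deriv \<psi> z\<bar>" "\<bar>deriv \<psi> z\<bar> \<le> m powr (1 + \<theta>)"
        using e(2)[of z] sub[of z] z up assms(7)[of z] by (auto simp: m_def dist_commute)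
      ultimately show ?thesis by (simp add: mult_right_mono)
    qed
    have "?P (ball c e) m"
    proof (intro conjI m ballI)
      fix x y assume "x \<in> ball c e" "y \<in> ball c e"
      thus "m * dist x y \<le> dist (\<psi> x) (\<psi> y)" "dist (\<psi> x) (\<psi> y) \<le> m powr (1 + \<theta>) * dist x y"
        using mvt[of x y] mvt[of y x] by (cases x y rule: linorder_cases; simp add: dist_commute)+
    qed
    thus ?thesis using e(1) by (intro exI[of _ "ball c e"]) auto
  qed
  \<comment> \<open>The open sets on which a single rate \<open>m\<close> works cover
    \<open>K\<close>; \<rho> is a Lebesgue number of this cover.\<close>
  define \<G> where "\<G> = {B. open B \<and> (\<exists>m. ?P B m)}"
  have "K \<subseteq> \<Union>\<G>"
  proof
    fix c assume "c \<in> K"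
    from loc[OF this] show "c \<in> \<Union>\<G>" unfolding \<G>_def by (elim exE conjE) (rule UnionI, auto)
  qed
  moreover have "open B" if "B \<in> \<G>" for B using that by (simp add: \<G>_def)
  ultimately obtain \<rho> where \<rho>: "\<rho> > 0" "\<And>x. x \<in> K \<Longrightarrow> \<exists>G\<in>\<G>. ball x \<rho> \<subseteq> G"
    using Heine_Borel_lemma[OF assms(1), of \<G>] by metis
  show ?thesis
  proof (rule exI[of _ \<rho>], intro conjI \<rho>(1) ballI)
    fix x0 assume "x0 \<in> K"
    then obtain G where "G \<in> \<G>" and G: "ball x0 \<rho> \<subseteq> G" using \<rho>(2) by blast
    then obtain m where "?P G m" unfolding \<G>_def by (elim CollectE conjE exE) simp
    with G have "?P (ball x0 \<rho>) m" by (meson subsetD)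
    thus "\<exists>m\<ge>\<sigma>. \<forall>x\<in>ball x0 \<rho>. \<forall>y\<in>ball x0 \<rho>.
           m * dist x y \<le> dist (\<psi> x) (\<psi> y) \<and> dist (\<psi> x) (\<psi> y) \<le> m powr (1 + \<theta>) * dist x y"
      by (intro exI[of _ m])
  qed
qed

text \<open>Without a modulus of continuity for the derivative there is no bounded distortion; the
  exponent \<open>1 + \<theta>\<close> absorbs the accumulated distortion of the iterates.\<close>

lemma expanding_map_iterate:
  fixes \<psi> :: "'a::metric_space \<Rightarrow> 'a"
  assumes "\<psi> ` K \<subseteq> K" "\<sigma> > 1" "\<theta> \<ge> 0"
    and local_distortion: "\<And>x0. x0 \<in> K \<Longrightarrow> \<exists>m\<ge>\<sigma>. \<forall>x\<in>ball x0 \<rho>. \<forall>y\<in>ball x0 \<rho>.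
           m * dist x y \<le> dist (\<psi> x) (\<psi> y) \<and> dist (\<psi> x) (\<psi> y) \<le> m powr (1 + \<theta>) * dist x y"
    and "W \<subseteq> K" "W \<noteq> {}" "D > 0" "\<And>x y. x \<in> W \<Longrightarrow> y \<in> W \<Longrightarrow> dist x y \<le> D"
  shows "\<exists>f L. L \<ge> 1 \<and> f ` W \<subseteq> K \<and> \<rho> \<le> L powr (1 + \<theta>) * D \<and>
           (\<forall>x\<in>W. \<forall>y\<in>W. L * dist x y \<le> dist (f x) (f y))"
proof -
  \<comment> \<open>The induction follows the bound \<open>D\<close>, not the true size of
    \<open>W\<close>, so it also ends for single points: each use of \<psi> enlarges the bound by at
    least the factor \<sigma>.\<close>
  obtain k where "\<rho> / D < \<sigma> ^ k" using real_arch_pow[OF assms(2)] by blast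
  hence "\<rho> \<le> D * \<sigma> ^ k" using assms(7) by (simp add: field_simps)
  thus ?thesis using assms(5-8)
  proof (induction k arbitrary: W D)
    case 0
    thus ?case by (intro exI[of _ id] exI[of _ "1::real"]) auto
  next
    case (Suc k)
    show ?case
    proof (cases "\<rho> \<le> D")
      case True
      thus ?thesis using Suc.prems by (intro exI[of _ id] exI[of _ "1::real"]) auto
    next
      case False
      obtain x0 where x0: "x0 \<in> W" using Suc.prems by blast
      have Wb: "W \<subseteq> ball x0 \<rho>"
      proof
        fix y assume "y \<in> W"
        thus "y \<in> ball x0 \<rho>" using Suc.prems(5)[OF x0 \<open>y \<in> W\<close>] False by simp
      qed
      obtain m where m: "m \<ge> \<sigma>" "\<And>x y. x \<in> W \<Longrightarrow> y \<in> W \<Longrightarrow>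
           m * dist x y \<le> dist (\<psi> x) (\<psi> y) \<and> dist (\<psi> x) (\<psi> y) \<le> m powr (1 + \<theta>) * dist x y"
        using local_distortion[of x0] x0 Suc.prems(2) Wb by (meson subsetD)
      have m1: "m > 1" using m(1) assms(2) by simp
      \<comment> \<open>The bound grows at the upper rate, while \<open>L\<close> collects the lower
        rates \<open>m\<close>; this keeps the exponent \<open>1 + \<theta>\<close> linking the
        two.\<close>
      let ?D = "m powr (1 + \<theta>) * D"
      have "\<exists>f L. L \<ge> 1 \<and> f ` (\<psi> ` W) \<subseteq> K \<and> \<rho> \<le> L powr (1 + \<theta>) * ?D \<and>
           (\<forall>x\<in>\<psi> ` W. \<forall>y\<in>\<psi> ` W. L * dist x y \<le> dist (f x) (f y))"
      proof (rule Suc.IH)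
        have "\<sigma> \<le> m powr 1" using m(1) m1 by simp
        also have "\<dots> \<le> m powr (1 + \<theta>)" using m1 assms(3) by (intro powr_mono) auto
        finally have "D * \<sigma> * \<sigma> ^ k \<le> ?D * \<sigma> ^ k"
          using Suc.prems(4) assms(2) by (intro mult_right_mono) (auto simp: mult.commute)
        thus "\<rho> \<le> ?D * \<sigma> ^ k" using Suc.prems(1) by (simp add: mult.assoc)
        show "dist x y \<le> ?D" if "x \<in> \<psi> ` W" "y \<in> \<psi> ` W" for x y
        proof -
          obtain u v where uv: "x = \<psi> u" "y = \<psi> v" "u \<in> W" "v \<in> W" using \<open>x \<in> \<psi> ` W\<close> \<open>y \<in> \<psi> ` W\<close> by blast
          have "dist x y \<le> m powr (1 + \<theta>) * dist u v" using m(2)[OF uv(3,4)] uv by simp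
          also have "\<dots> \<le> ?D" using Suc.prems(5)[OF uv(3,4)] by (intro mult_left_mono) auto
          finally show ?thesis .
        qed
        show "\<psi> ` W \<subseteq> K" using Suc.prems(2) assms(1) by blast
      qed (use Suc.prems m1 in auto)
      then obtain f L where fL: "L \<ge> 1" "f ` (\<psi> ` W) \<subseteq> K" "\<rho> \<le> L powr (1 + \<theta>) * ?D"
           "\<forall>x\<in>\<psi> ` W. \<forall>y\<in>\<psi> ` W. L * dist x y \<le> dist (f x) (f y)"
        by (elim exE conjE)
      have "L * m * dist x y \<le> dist (f (\<psi> x)) (f (\<psi> y))" if "x \<in> W" "y \<in> W" for x y
      proof -
        have "L * (m * dist x y) \<le> L * dist (\<psi> x) (\<psi> y)"
          using m(2)[OF that] fL(1) by (intro mult_left_mono) auto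
        moreover have "L * dist (\<psi> x) (\<psi> y) \<le> dist (f (\<psi> x)) (f (\<psi> y))"
          using fL(4) that by simp
        ultimately show ?thesis by simp
      qed
      moreover have "1 \<le> L * m" using mult_mono[of 1 L 1 m] fL(1) m1 by simp
      moreover have "\<rho> \<le> (L * m) powr (1 + \<theta>) * D"
        using fL(1,3) m1 by (simp add: powr_mult mult.assoc)
      ultimately show ?thesis
        using fL(2) by (intro exI[of _ "f \<circ> \<psi>"] exI[of _ "L * m"]) auto
    qed
  qed
qed

section \<open>Covering numbers of regular Cantor sets\<close>

text \<open>With \<open>1 + \<theta> = s / s'\<close>, blowing a piece of size \<open>D i\<close> up
  to size \<rho> gives \<open>L i powr - s\<close> \<le> \<open>(D i / \<rho>) powr s'\<close>. A
  cover whose \<open>s'\<close>-sum is below \<open>\<rho> powr s'\<close> thus yields the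
  hypothesis of \<open>coverable_self_expanding\<close>.\<close>

lemma expanding_repeller_coverable:
  fixes \<psi> :: "real \<Rightarrow> real"
  assumes K: "compact K" "open U" "K \<subseteq> U" "\<psi> differentiable_on U" "continuous_on U (deriv \<psi>)"
    and "\<sigma> > 1" "\<And>x. x \<in> U \<Longrightarrow> \<bar>deriv \<psi> x\<bar> \<ge> \<sigma>" "\<psi> ` K \<subseteq> K"
    and s': "0 < s'" "s' < s" "hausdorff_outer_measure s' K = 0"
  shows "\<exists>A\<ge>0. \<forall>\<epsilon>. 0 < \<epsilon> \<longrightarrow> \<epsilon> \<le> 1 \<longrightarrow> coverable K \<epsilon> (A * \<epsilon> powr - s)"
proof -
  define \<theta> where "\<theta> = s / s' - 1"
  have \<theta>: "\<theta> > 0" "(1 + \<theta>) * s' = s" using s' by (auto simp: \<theta>_def field_simps)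
  obtain \<rho> where \<rho>: "\<rho> > 0" "\<And>x0. x0 \<in> K \<Longrightarrow> \<exists>m\<ge>\<sigma>. \<forall>x\<in>ball x0 \<rho>. \<forall>y\<in>ball x0 \<rho>.
           m * dist x y \<le> dist (\<psi> x) (\<psi> y) \<and> dist (\<psi> x) (\<psi> y) \<le> m powr (1 + \<theta>) * dist x y"
    using expanding_map_local_distortion[OF K assms(6,7) \<theta>(1)] by blast
  obtain F0 :: "nat set" and V D where F0: "finite F0" "K \<subseteq> (\<Union>i\<in>F0. V i)" "\<And>i. i \<in> F0 \<Longrightarrow> D i > 0"
      "\<And>i x y. i \<in> F0 \<Longrightarrow> x \<in> V i \<Longrightarrow> y \<in> V i \<Longrightarrow> dist x y \<le> D i"
      "(\<Sum>i\<in>F0. D i powr s') < \<rho> powr s'"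
    using hausdorff_null_finite_cover[OF K(1) s'(3,1), of "\<rho> powr s'"] \<rho>(1)
    by (smt (verit, ccfv_threshold) powr_gt_zero)
  \<comment> \<open>Pieces that miss \<open>K\<close> are dropped, since only nonempty sets can be
    blown up.\<close>
  define F where "F = {i \<in> F0. V i \<inter> K \<noteq> {}}"
  have F: "finite F" "F \<subseteq> F0" using F0(1) by (auto simp: F_def)
  have FK: "K \<subseteq> (\<Union>i\<in>F. V i \<inter> K)"
  proof
    fix x assume x: "x \<in> K"
    then obtain i where "i \<in> F0" "x \<in> V i" using subsetD[OF F0(2) x] by (elim UN_E)
    with x show "x \<in> (\<Union>i\<in>F. V i \<inter> K)" by (intro UN_I[of i]) (auto simp: F_def)
  qed
  have "\<exists>f L. L \<ge> 1 \<and> f ` (V i \<inter> K) \<subseteq> K \<and> \<rho> \<le> L powr (1 + \<theta>) * D i \<and>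
           (\<forall>x\<in>V i \<inter> K. \<forall>y\<in>V i \<inter> K. L * dist x y \<le> dist (f x) (f y))" if "i \<in> F" for i
    using \<theta>(1) that F0 by (intro expanding_map_iterate[OF assms(8,6) _ \<rho>(2)]) (auto simp: F_def)
  then obtain f L where fL: "\<And>i. i \<in> F \<Longrightarrow> L i \<ge> 1" "\<And>i. i \<in> F \<Longrightarrow> f i ` (V i \<inter> K) \<subseteq> K"
      "\<And>i. i \<in> F \<Longrightarrow> \<rho> \<le> L i powr (1 + \<theta>) * D i"
      "\<And>i x y. i \<in> F \<Longrightarrow> x \<in> V i \<inter> K \<Longrightarrow> y \<in> V i \<inter> K \<Longrightarrow> L i * dist x y \<le> dist (f i x) (f i y)"
    by metis
  have Ls: "L i powr - s \<le> D i powr s' / \<rho> powr s'" if i: "i \<in> F" for i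
  proof -
    have "\<rho> powr s' \<le> (L i powr (1 + \<theta>) * D i) powr s'"
      using fL(3)[OF i] \<rho>(1) s'(1) by (intro powr_mono2) auto
    also have "\<dots> = L i powr s * D i powr s'"
      using \<theta>(2) F0(3) i F(2) by (simp add: powr_mult powr_powr less_imp_le subset_iff)
    finally show ?thesis using \<rho>(1) fL(1)[OF i] by (simp add: powr_minus field_simps)
  qed
  have sumF: "(\<Sum>i\<in>F. D i powr s' / \<rho> powr s') < 1"
  proof -
    have "(\<Sum>i\<in>F. D i powr s') \<le> (\<Sum>i\<in>F0. D i powr s')"
      using F F0(1) by (intro sum_mono2) auto
    thus ?thesis using F0(5) \<rho>(1) by (simp add: sum_divide_distrib[symmetric])
  qed
  \<comment> \<open>If \<open>L i\<close> were 1, its term alone would push the sum up to 1.\<close>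
  have L1: "L i > 1" if i: "i \<in> F" for i
  proof (rule ccontr)
    assume "\<not> L i > 1"
    hence "L i = 1" using fL(1)[OF i] by simp
    hence "1 \<le> D i powr s' / \<rho> powr s'" using Ls[OF i] by simp
    also have "\<dots> \<le> (\<Sum>i\<in>F. D i powr s' / \<rho> powr s')"
      using i F(1) by (intro member_le_sum) auto
    finally show False using sumF by simp
  qed
  have "(\<Sum>i\<in>F. L i powr - s) \<le> (\<Sum>i\<in>F. D i powr s' / \<rho> powr s')"
    by (intro sum_mono Ls)
  hence "(\<Sum>i\<in>F. L i powr - s) \<le> 1" using sumF by simp
  thus ?thesis
    using s' by (intro coverable_self_expanding[OF K(1) F(1) _ FK L1 fL(2,4)]) auto
qed

text \<open>The infimum in \<open>hausdorff_dim\<close> supplies an exponent \<open>s' < s\<close>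
  of measure zero; the difference of the two pays for the distortion.\<close>

lemma regular_cantor_set_coverable:
  assumes "regular_cantor_set K" "hausdorff_dim K < ereal s"
  shows "\<exists>A\<ge>0. \<forall>\<epsilon>. 0 < \<epsilon> \<longrightarrow> \<epsilon> \<le> 1 \<longrightarrow> coverable K \<epsilon> (A * \<epsilon> powr - s)"
proof -
  obtain s' where s': "0 < s'" "s' < s" "hausdorff_outer_measure s' K = 0"
    using assms(2) unfolding hausdorff_dim_def Inf_less_iff by auto
  obtain k where k: "k \<ge> 1" "Ck_regular_cantor_set k K"
    using assms(1) unfolding regular_cantor_set_def by blast
  have K: "compact K" using k(2) unfolding Ck_regular_cantor_set_def cantor_set_def by blast
  obtain r :: nat and a b :: "nat \<Rightarrow> real" and U \<psi> \<sigma> where *: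
    "K \<subseteq> (\<Union>s<r. {a s..b s})" "open U" "(\<Union>s<r. {a s..b s}) \<subseteq> U" "C_k_on k \<psi> U"
    "\<sigma> > 1" "\<forall>x\<in>U. \<bar>deriv \<psi> x\<bar> \<ge> \<sigma>"
    "K = (\<Inter>n. (\<psi> ^^ n) -` (\<Union>s<r. {a s..b s}))"
    using k(2) unfolding Ck_regular_cantor_set_def by (elim conjE exE) (rule that, assumption+)
  have diff: "\<psi> differentiable_on U" using *(4) k(1) by (auto simp: C_k_on_def dest: spec[of _ 0])
  have cont: "continuous_on U (deriv \<psi>)"
  proof (cases "k = 1")
    case True
    thus ?thesis using *(4) by (simp add: C_k_on_def)
  next
    case False
    hence "1 < k" using k(1) by simp
    hence "(deriv ^^ 1) \<psi> differentiable_on U" using *(4) unfolding C_k_on_def by blast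
    thus ?thesis by (simp add: differentiable_imp_continuous_on)
  qed
  \<comment> \<open>Invariance comes from shifting the index in the intersection of preimages by
    one.\<close>
  have "\<psi> x \<in> K" if "x \<in> K" for x
  proof -
    have "(\<psi> ^^ n) (\<psi> x) \<in> (\<Union>s<r. {a s..b s})" for n
    proof -
      have "x \<in> (\<psi> ^^ Suc n) -` (\<Union>s<r. {a s..b s})" using that by (subst (asm) *(7)) (rule INT_D, auto)
      thus ?thesis by (simp add: funpow_swap1)
    qed
    thus ?thesis by (subst *(7)) (intro INT_I vimageI2)
  qed
  hence "\<psi> ` K \<subseteq> K" by blast
  thus ?thesis
    using *(1,3,6) by (intro expanding_repeller_coverable[OF K *(2) _ diff cont *(5) _ _ s']) auto
qed

section \<open>Gaps and the parameters they exclude\<close>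

text \<open>Countable subadditivity along an enumeration of \<open>I\<close>, padded with empty sets
  and zero terms outside its range, so that finite \<open>I\<close> is included.\<close>

lemma emeasure_UN_le_infsum:
  fixes g :: "'i \<Rightarrow> real"
  assumes "countable I" "\<And>i. i \<in> I \<Longrightarrow> A i \<in> sets M" "\<And>i. i \<in> I \<Longrightarrow> emeasure M (A i) \<le> ennreal (g i)"
    and "\<And>i. i \<in> I \<Longrightarrow> g i \<ge> 0" "g summable_on I"
  shows "emeasure M (\<Union>i\<in>I. A i) \<le> ennreal (infsum g I)"
proof -
  let ?J = "to_nat_on I ` I" and ?v = "from_nat_into I"
  define B where "B n = (if n \<in> ?J then A (?v n) else {})" for n
  define h where "h n = (if n \<in> ?J then g (?v n) else 0)" for n
  have inj: "inj_on (to_nat_on I) I" using assms(1) by (rule inj_on_to_nat_on)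
  have v: "?v (to_nat_on I i) = i" if "i \<in> I" for i using assms(1) that by simp
  have "(g has_sum infsum g I) I" using assms(5) by simp
  hence "((\<lambda>n. g (?v n)) has_sum infsum g I) ?J"
    unfolding has_sum_reindex[OF inj] by (rule has_sum_cong[THEN iffD1, rotated]) (simp add: v)
  hence "(h has_sum infsum g I) UNIV"
    by (rule has_sum_cong_neutral[THEN iffD1, rotated -1]) (auto simp: h_def)
  hence sums: "h sums infsum g I" by (rule has_sum_imp_sums)
  have h0: "h n \<ge> 0" for n using assms(4) by (auto simp: h_def v)
  have "(\<Union>i\<in>I. A i) = (\<Union>n. B n)"
    by (auto simp: B_def v split: if_splits)
  also have "emeasure M \<dots> \<le> (\<Sum>n. emeasure M (B n))"
    using assms(2) by (intro emeasure_subadditive_countably) (auto simp: B_def v)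
  also have "\<dots> \<le> (\<Sum>n. ennreal (h n))"
    using assms(3) by (intro suminf_le) (auto simp: B_def h_def v)
  also have "\<dots> = ennreal (infsum g I)"
    using sums h0 by (subst suminf_ennreal2) (auto simp: sums_iff)
  finally show ?thesis .
qed

text \<open>Compactness gives a last point of \<open>K\<close> to the left of \<open>x\<close> and a
  first one to the right. A connected set that contains \<open>x\<close> and reaches beyond them
  would contain one of the two.\<close>

lemma gaps_cover:
  assumes "compact K" "x \<in> convex hull K" "x \<notin> K"
  shows "\<exists>(a, b)\<in>gaps K. x \<in> {a<..<b}"
proof -
  let ?H = "convex hull K"
  have ne: "K \<noteq> {}" using assms(2) by auto
  have le: "Inf K \<le> y" "y \<le> Sup K" if "y \<in> K" for y
    using that assms(1)
    by (auto intro!: cInf_lower cSup_upper bounded_imp_bdd_below bounded_imp_bdd_above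
        compact_imp_bounded)
  have mem: "Inf K \<in> K" "Sup K \<in> K"
    using assms(1) ne
    by (auto intro!: closed_contains_Inf closed_contains_Sup compact_imp_closed
        bounded_imp_bdd_below bounded_imp_bdd_above compact_imp_bounded)
  have "K \<subseteq> {Inf K..Sup K}" using le by auto
  hence HK: "?H \<subseteq> {Inf K..Sup K}" by (intro hull_minimal) auto
  hence x: "Inf K \<le> x" "x \<le> Sup K" using assms(2) by auto
  define A where "A = K \<inter> {..x}"
  define B where "B = K \<inter> {x..}"
  have cA: "compact A" "compact B"
    using assms(1) by (auto simp: A_def B_def)
  have neA: "A \<noteq> {}" "B \<noteq> {}" using mem x by (auto simp: A_def B_def)
  obtain a where a: "a \<in> A" "\<And>y. y \<in> A \<Longrightarrow> y \<le> a" using compact_attains_sup[OF cA(1) neA(1)] by blast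
  obtain b where b: "b \<in> B" "\<And>y. y \<in> B \<Longrightarrow> b \<le> y" using compact_attains_inf[OF cA(2) neA(2)] by blast
  have aK: "a \<in> K" "a < x" and bK: "b \<in> K" "x < b"
    using a(1) b(1) assms(3) by (auto simp: A_def B_def less_le)
  have sub: "{a<..<b} \<subseteq> ?H - K"
  proof
    fix y assume y: "y \<in> {a<..<b}"
    have "y \<notin> K" using a(2)[of y] b(2)[of y] y by (force simp: A_def B_def)
    moreover have "{a..b} \<subseteq> ?H"
      using aK bK hull_inc[of _ K convex] convex_contains_segment[of ?H] convex_convex_hull[of K]
      by (metis atLeastatMost_empty_iff closed_segment_eq_real_ivl empty_subsetI)
    ultimately show "y \<in> ?H - K" using y by auto
  qed
  have "{a<..<b} \<in> components (?H - K)"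
    unfolding in_components_maximal
  proof (intro conjI allI impI sub)
    show "{a<..<b} \<noteq> {}" using aK bK by auto
    show "connected {a<..<b}" by simp
    fix c assume c: "c \<noteq> {} \<and> {a<..<b} \<subseteq> c \<and> c \<subseteq> ?H - K \<and> connected c"
    hence xc: "x \<in> c" using aK bK by auto
    have "y \<in> {a<..<b}" if "y \<in> c" for y
    proof (rule ccontr)
      assume "y \<notin> {a<..<b}"
      hence "y \<le> a \<or> b \<le> y" by auto
      hence "a \<in> c \<or> b \<in> c"
        using c that xc aK bK by (meson connected_contains_Icc atLeastAtMost_iff less_imp_le subsetD)
      thus False using c aK bK by auto
    qed
    thus "c = {a<..<b}" using c by auto
  qed
  thus ?thesis using aK bK by (intro bexI[of _ "(a, b)"]) (auto simp: gaps_def)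
qed

lemma gap_less:
  assumes "(a, b) \<in> gaps K"
  shows "a < b"
  using in_components_nonempty[of "{a<..<b}" "convex hull K - K"] assms by (simp add: gaps_def)

text \<open>The parameters \<open>t\<close> for which \<open>t + l * x\<close> hits the gap for some
  \<open>x\<close> in \<open>K\<close>. Removing the gap itself is harmless, as only
  \<open>t\<close> in \<open>K'\<close> will be counted, and essential: its length does not shrink
  with \<open>l\<close>.\<close>

definition gap_shadow :: "real set \<Rightarrow> real \<Rightarrow> real \<times> real \<Rightarrow> real set" where
  "gap_shadow K l = (\<lambda>(a, b). (\<Union>x\<in>K. {a - l * x<..<b - l * x}) - {a<..<b})"

lemma gap_shadow_sets: "gap_shadow K l g \<in> sets lebesgue"
proof -
  obtain a b where g: "g = (a, b)" by force
  have "open (\<Union>x\<in>K. {a - l * x<..<b - l * x})" by auto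
  thus ?thesis unfolding gap_shadow_def g by auto
qed

text \<open>A gap of length at least \<open>l\<close> only has margins of length
  \<open>l * R\<close> at its two ends. For a shorter gap, \<open>K\<close> is covered at scale
  \<open>(b - a) / l\<close>, and each piece sweeps out at most \<open>3 * (b - a)\<close>. The
  constant adds up both cases.\<close>

lemma emeasure_gap_shadow_le:
  fixes K :: "real set"
  assumes "a < b" "l > 0" "\<And>x. x \<in> K \<Longrightarrow> \<bar>x\<bar> \<le> R" "R \<ge> 0" "A \<ge> 0" "0 < p" "p < 1"
    and cov: "\<And>\<epsilon>. 0 < \<epsilon> \<Longrightarrow> \<epsilon> \<le> 1 \<Longrightarrow> coverable K \<epsilon> (A * \<epsilon> powr - (1 - p))"
  shows "emeasure lebesgue (gap_shadow K l (a, b))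
    \<le> ennreal ((2 * R + 3 * A) * l powr (1 - p) * (b - a) powr p)"
proof (cases "b - a \<ge> l")
  case True
  have "gap_shadow K l (a, b) \<subseteq> {a - l * R..a} \<union> {b..b + l * R}"
  proof -
    have "\<bar>l * x\<bar> \<le> l * R" if "x \<in> K" for x
      using assms(2) assms(3)[OF that] by (simp add: abs_mult)
    thus ?thesis unfolding gap_shadow_def by (fastforce simp: abs_le_iff)
  qed
  hence "emeasure lebesgue (gap_shadow K l (a, b)) \<le> emeasure lebesgue ({a - l * R..a} \<union> {b..b + l * R})"
    by (intro emeasure_mono) auto
  also have "\<dots> \<le> emeasure lebesgue {a - l * R..a} + emeasure lebesgue {b..b + l * R}"
    by (intro emeasure_subadditive) auto
  also have "\<dots> = ennreal (2 * R * l)"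
    using assms by (simp flip: ennreal_plus add: algebra_simps)
  also have "\<dots> \<le> ennreal ((2 * R + 3 * A) * l powr (1 - p) * (b - a) powr p)"
  proof (intro ennreal_leI)
    \<comment> \<open>Only \<open>l powr p\<close> is traded for \<open>(b - a) powr p\<close>; the
      factor \<open>l powr (1 - p)\<close> must remain to make the bound vanish with
      \<open>l\<close>.\<close>
    have "2 * R * l = 2 * R * (l powr (1 - p) * l powr p)"
      using assms(2) by (simp add: powr_add[symmetric])
    also have "\<dots> \<le> (2 * R + 3 * A) * (l powr (1 - p) * (b - a) powr p)"
      using assms True by (intro mult_mono mult_left_mono powr_mono2) auto
    finally show "2 * R * l \<le> (2 * R + 3 * A) * l powr (1 - p) * (b - a) powr p" by (simp add: mult_ac)
  qed
  finally show ?thesis .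
next
  case False
  define \<epsilon> where "\<epsilon> = (b - a) / l"
  have \<epsilon>: "0 < \<epsilon>" "\<epsilon> \<le> 1" "l * \<epsilon> = b - a" using assms(1,2) False by (auto simp: \<epsilon>_def)
  obtain \<C> where C: "finite \<C>" "real (card \<C>) \<le> A * \<epsilon> powr - (1 - p)" "K \<subseteq> \<Union>\<C>"
      "\<And>B x y. B \<in> \<C> \<Longrightarrow> x \<in> B \<Longrightarrow> y \<in> B \<Longrightarrow> dist x y \<le> \<epsilon>"
    using cov[OF \<epsilon>(1,2)] unfolding coverable_def by blast
  define c where "c B = (SOME x. x \<in> B)" for B :: "real set"
  \<comment> \<open>Moving \<open>x\<close> within a piece shifts the translated gap by at most
    \<open>l * \<epsilon> = b - a\<close>, hence the margin on both sides.\<close>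
  define J where "J B = {a - l * c B - (b - a)..b - l * c B + (b - a)}" for B
  have "gap_shadow K l (a, b) \<subseteq> (\<Union>B\<in>\<C>. J B)"
  proof
    fix t assume "t \<in> gap_shadow K l (a, b)"
    then obtain x where x: "x \<in> K" "a - l * x < t" "t < b - l * x" by (auto simp: gap_shadow_def)
    then obtain B where B: "B \<in> \<C>" "x \<in> B" using C(3) by blast
    have "c B \<in> B" unfolding c_def using B(2) by (rule someI)
    hence "\<bar>x - c B\<bar> \<le> \<epsilon>" using C(4)[OF B] by (simp add: dist_real_def)
    hence "l * \<bar>x - c B\<bar> \<le> b - a" using \<epsilon>(3) assms(2) mult_left_mono[of _ \<epsilon> l] by fastforce
    hence "\<bar>l * x - l * c B\<bar> \<le> b - a"
      using assms(2) by (simp add: abs_mult right_diff_distrib[symmetric])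
    hence "t \<in> J B" using x by (auto simp: J_def)
    thus "t \<in> (\<Union>B\<in>\<C>. J B)" using B by blast
  qed
  hence "emeasure lebesgue (gap_shadow K l (a, b)) \<le> emeasure lebesgue (\<Union>B\<in>\<C>. J B)"
    using C(1) by (intro emeasure_mono) (auto simp: J_def)
  also have "\<dots> \<le> (\<Sum>B\<in>\<C>. emeasure lebesgue (J B))"
    using C(1) by (intro emeasure_subadditive_finite) (auto simp: J_def)
  also have "\<dots> = (\<Sum>B\<in>\<C>. ennreal (3 * (b - a)))"
    using assms(1) by (intro sum.cong) (auto simp: J_def algebra_simps)
  also have "\<dots> = ennreal (real (card \<C>) * (3 * (b - a)))"
    using assms(1) by (subst sum_ennreal) auto
  also have "\<dots> \<le> ennreal ((2 * R + 3 * A) * l powr (1 - p) * (b - a) powr p)"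
  proof (intro ennreal_leI)
    have q: "(b - a) powr (1 - p) \<noteq> 0" using assms(1) by simp
    have "\<epsilon> powr - (1 - p) * (b - a) =
        inverse ((b - a) powr (1 - p) / l powr (1 - p)) * ((b - a) powr (1 - p) * (b - a) powr p)"
      unfolding \<epsilon>_def powr_minus powr_divide using assms(1) by (simp flip: powr_add)
    also have "\<dots> = l powr (1 - p) * (b - a) powr p" using q by simp
    finally have e: "\<epsilon> powr - (1 - p) * (b - a) = l powr (1 - p) * (b - a) powr p" .
    have "real (card \<C>) * (3 * (b - a)) \<le> A * \<epsilon> powr - (1 - p) * (3 * (b - a))"
      using C(2) assms(1) by (intro mult_right_mono) auto
    also have "\<dots> = 3 * A * (l powr (1 - p) * (b - a) powr p)" unfolding e[symmetric] by simp
    also have "\<dots> \<le> (2 * R + 3 * A) * (l powr (1 - p) * (b - a) powr p)"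
      using assms by (intro mult_right_mono) auto
    finally show "real (card \<C>) * (3 * (b - a)) \<le> (2 * R + 3 * A) * l powr (1 - p) * (b - a) powr p"
      by (simp add: mult_ac)
  qed
  finally show ?thesis .
qed

section \<open>Measure of the surviving parameters\<close>

theorem proposition0p5:
  fixes K K' :: "real set" and d p :: real
  assumes "regular_cantor_set K"
    and "hausdorff_dim K = ereal d"
    and "0 < p" and "p < 1"
    and "cantor_set K'"
    and "emeasure lebesgue K' > 0"
    and "gap_condition p K'"
    and "d + p < 1"
  shows "\<forall>\<^sub>F l in at_right (0::real).
           emeasure lebesgue {t :: real. (\<lambda>x. t + l * x) ` K \<subseteq> K'} > 0"
proof -
  obtain A where A: "A \<ge> 0" "\<And>\<epsilon>. 0 < \<epsilon> \<Longrightarrow> \<epsilon> \<le> 1 \<Longrightarrow> coverable K \<epsilon> (A * \<epsilon> powr - (1 - p))"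
    using regular_cantor_set_coverable[OF assms(1), of "1 - p"] assms(2,8) by auto
  have K: "compact K"
    using assms(1) unfolding regular_cantor_set_def Ck_regular_cantor_set_def cantor_set_def by blast
  obtain R where R: "R > 0" "\<And>x. x \<in> K \<Longrightarrow> \<bar>x\<bar> \<le> R"
    using compact_imp_bounded[OF K] unfolding bounded_pos real_norm_def by blast
  have K': "compact K'" "K' \<noteq> {}" using assms(5) by (auto simp: cantor_set_def)
  have summ: "(\<lambda>(a, b). (b - a) powr p) summable_on gaps K'"
    using assms(7) by (simp add: gap_condition_def)
  \<comment> \<open>Gap lengths are positive, so every term of the convergent sum is nonzero and the
    gaps are countable.\<close>
  have "countable {g \<in> gaps K'. (case g of (a, b) \<Rightarrow> (b - a) powr p) \<noteq> 0}"
    by (rule summable_countable_real[OF summ])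
  moreover have "{g \<in> gaps K'. (case g of (a, b) \<Rightarrow> (b - a) powr p) \<noteq> 0} = gaps K'"
    using gap_less by fastforce
  ultimately have count: "countable (gaps K')" by simp
  define S where "S = (\<Sum>\<^sub>\<infinity>(a, b)\<in>gaps K'. (b - a) powr p)"
  have "connected (convex hull K')" "compact (convex hull K')"
    using K'(1) by (auto simp: compact_convex_hull convex_connected)
  then obtain u v where hull: "convex hull K' = {u..v}"
    using connected_compact_interval_1 by metis
  \<comment> \<open>Near the ends of the hull, \<open>t + l * x\<close> may leave the hull instead
    of falling into a gap.\<close>
  define Z where "Z l = {u..u + l * R} \<union> {v - l * R..v}" for l
  define C where "C = 2 * R + 3 * A"
  have C: "C \<ge> 0" using A R by (simp add: C_def)
  have S0: "S \<ge> 0" unfolding S_def by (intro infsum_nonneg) auto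
  define good where "good l = {t. (\<lambda>x. t + l * x) ` K \<subseteq> K'}" for l
  have bound: "emeasure lebesgue K'
      \<le> emeasure lebesgue (good l) + ennreal (C * l powr (1 - p) * S + 2 * l * R)"
    if l: "l > 0" for l
  proof -
    have "closed ((\<lambda>t. t + l * x) -` K')" for x
      using K'(1) by (intro continuous_closed_vimage compact_imp_closed continuous_intros)
    moreover have "good l = (\<Inter>x\<in>K. (\<lambda>t. t + l * x) -` K')" by (auto simp: good_def)
    ultimately have "closed (good l)" by auto
    hence good: "good l \<in> sets lebesgue" by auto
    let ?G = "\<Union>g\<in>gaps K'. gap_shadow K l g"
    have G: "?G \<in> sets lebesgue"
      using count by (intro sets.countable_UN') (auto simp: gap_shadow_sets)
    have Z: "Z l \<in> sets lebesgue" by (auto simp: Z_def)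
    have cover: "K' \<subseteq> good l \<union> (?G \<union> Z l)"
    proof
      fix t assume t: "t \<in> K'"
      show "t \<in> good l \<union> (?G \<union> Z l)"
      proof (cases "t \<in> good l")
        case False
        then obtain x where x: "x \<in> K" "t + l * x \<notin> K'" by (auto simp: good_def)
        show ?thesis
        proof (cases "t + l * x \<in> convex hull K'")
          case True
          then obtain a b where ab: "(a, b) \<in> gaps K'" "t + l * x \<in> {a<..<b}"
            using gaps_cover[OF K'(1) True x(2)] by auto
          have "{a<..<b} \<subseteq> convex hull K' - K'"
            using ab(1) in_components_subset by (auto simp: gaps_def)
          \<comment> \<open>Since \<open>t\<close> lies in \<open>K'\<close>, it is outside the gap
            and survives its removal from the shadow.\<close>
          hence "t \<in> gap_shadow K l (a, b)" using ab(2) x(1) t by (force simp: gap_shadow_def)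
          thus ?thesis using ab(1) by blast
        next
          case False
          have "\<bar>l * x\<bar> \<le> l * R" using R(2)[OF x(1)] l by (simp add: abs_mult)
          moreover have "t \<in> {u..v}" using t hull_inc[of t K' convex] hull by auto
          ultimately have "t \<in> Z l" using False unfolding hull Z_def by (auto simp: abs_le_iff)
          thus ?thesis by blast
        qed
      qed auto
    qed
    have "emeasure lebesgue (Z l) \<le> emeasure lebesgue {u..u + l * R} + emeasure lebesgue {v - l * R..v}"
      unfolding Z_def by (intro emeasure_subadditive) auto
    also have "\<dots> = ennreal (2 * l * R)"
      using l R(1) by (simp flip: ennreal_plus)
    finally have Z_le: "emeasure lebesgue (Z l) \<le> ennreal (2 * l * R)" .
    have "emeasure lebesgue ?G 
        \<le> ennreal (\<Sum>\<^sub>\<infinity>g\<in>gaps K'. C * l powr (1 - p) * (case g of (a, b) \<Rightarrow> (b - a) powr p))"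
    proof (rule emeasure_UN_le_infsum[OF count])
      fix g assume g: "g \<in> gaps K'"
      obtain a b where ab: "g = (a, b)" by force
      show "emeasure lebesgue (gap_shadow K l g) 
        \<le> ennreal (C * l powr (1 - p) * (case g of (a, b) \<Rightarrow> (b - a) powr p))"
        unfolding ab C_def prod.case using g ab R A assms(3,4) l gap_less
        by (intro emeasure_gap_shadow_le) auto
      show "0 \<le> C * l powr (1 - p) * (case g of (a, b) \<Rightarrow> (b - a) powr p)"
        using C by (auto split: prod.splits)
    qed (use summ in \<open>auto simp: gap_shadow_sets intro: summable_on_cmult_right\<close>)
    also have "(\<Sum>\<^sub>\<infinity>g\<in>gaps K'. C * l powr (1 - p) * (case g of (a, b) \<Rightarrow> (b - a) powr p))
        = C * l powr (1 - p) * S"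
      unfolding S_def using summ by (intro infsum_cmult_right) auto
    finally have G_le: "emeasure lebesgue ?G \<le> ennreal (C * l powr (1 - p) * S)" .
    have "emeasure lebesgue K' \<le> emeasure lebesgue (good l \<union> (?G \<union> Z l))"
      using cover good G Z by (intro emeasure_mono) auto
    also have "\<dots> \<le> emeasure lebesgue (good l) + emeasure lebesgue (?G \<union> Z l)"
      using good G Z by (intro emeasure_subadditive) auto
    also have "\<dots> \<le> emeasure lebesgue (good l) + (emeasure lebesgue ?G + emeasure lebesgue (Z l))"
      using G Z by (intro add_left_mono emeasure_subadditive) auto
    also have "\<dots> \<le> emeasure lebesgue (good l) + (ennreal (C * l powr (1 - p) * S) + ennreal (2 * l * R))"
      using G_le Z_le by (intro add_left_mono add_mono)
    finally show ?thesis
      using C S0 l R(1) by (simp flip: ennreal_plus)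
  qed
  define \<mu> where "\<mu> = measure lebesgue K'"
  have \<mu>: "emeasure lebesgue K' = ennreal \<mu>"
    unfolding \<mu>_def by (rule emeasure_eq_measure2[OF lmeasurable_compact[OF K'(1)]])
  hence \<mu>0: "\<mu> > 0" using assms(6) by simp
  \<comment> \<open>The limit is 0, by the convention for \<open>0 powr\<close>;
    \<open>p < 1\<close> makes the exponent positive.\<close>
  have lim: "((\<lambda>l::real. l powr (1 - p)) \<longlongrightarrow> 0 powr (1 - p)) (at_right 0)"
    using assms(4)
    by (intro tendsto_powr' tendsto_intros) (auto intro: eventually_mono[OF eventually_at_right_less])
  have "((\<lambda>l. C * l powr (1 - p) * S + 2 * l * R) \<longlongrightarrow> C * 0 powr (1 - p) * S + 2 * 0 * R) (at_right 0)"
    by (intro tendsto_add tendsto_mult tendsto_const tendsto_ident_at lim)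
  hence "\<forall>\<^sub>F l in at_right 0. C * l powr (1 - p) * S + 2 * l * R < \<mu>"
    using \<mu>0 by (intro order_tendstoD(2)) auto
  moreover have "\<forall>\<^sub>F l::real in at_right 0. l > 0" by (rule eventually_at_right_less)
  ultimately have "\<forall>\<^sub>F l in at_right 0. emeasure lebesgue (good l) > 0"
  proof eventually_elim
    case (elim l)
    show ?case
    proof (rule ccontr)
      assume "\<not> emeasure lebesgue (good l) > 0"
      hence "ennreal \<mu> \<le> ennreal (C * l powr (1 - p) * S + 2 * l * R)"
        using bound[OF elim(2)] \<mu> by (simp add: not_gr_zero)
      \<comment> \<open>Nonnegativity is required because \<open>ennreal\<close> truncates negative
        numbers to 0.\<close>
      moreover have "0 \<le> C * l powr (1 - p) * S + 2 * l * R"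
        using elim(2) C S0 R(1) by simp
      ultimately have "\<mu> \<le> C * l powr (1 - p) * S + 2 * l * R"
        by (metis ennreal_le_iff)
      thus False using elim(1) by simp
    qed
  qed
  thus ?thesis by (simp add: good_def)
qed

end
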